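(* The map $\mathcal{I}$ is an invariant of virtual pseudoknots. That is, if $P$ and $P'$ are two pseudo-Gauss diagrams which represent the same virtual pseudoknot (i.e. which are related by a finite sequence of the Gauss-diagrammatic moves R1, R2, R3, PR1, PR2, PR3), then $\mathcal{I}(P)=\mathcal{I}(P')$ in $\mathbb{Z}\mathcal{C}$.
   Context: **Pseudo-Gauss diagrams.** A pseudo-Gauss diagram is an oriented (counterclockwise) circle together with finitely many chords whose endpoints are pairwise distinct points of the circle. Each chord is an arrow (one endpoint is its tail, the other its head) of one of two kinds: a *classical arrow*, which carries a sign $+1$ or $-1$, or a *precrossing arrow*, which carries no sign. Diagrams are considered up to orientation-preserving homeomorphism of the circle. Two chords *intersect* if their endpoints alternate on the circle. (Geometrically, a classical arrow is a crossing, pointing from over-strand to under-strand, with sign the crossing sign; a precrossing arrow is a double point with missing crossing information, pointing in the direction the classical arrow would point if it were resolved to a positive crossing.) **Moves.** In each move the displayed arcs of the circle are disjoint and contain no chord endpoints other than those mentioned; everything else is unchanged. Each move may be performed in either direction. - R1: add or delete a classical arrow (any sign and direction) whose two endpoints lie consecutively on one arc. - R2: add or delete two classical arrows of opposite signs, whose two tails are consecutive on one arc and whose two heads are consecutive on another arc (in either order). - R3: there are three arcs $T,M,B$ and three classical arrows $a$ (from $T$ to $M$), $b$ (from $T$ to $B$), $c$ (from $M$ to $B$) with signs $\varepsilon_a,\varepsilon_b,\varepsilon_c$. Put $o_T=+1$ if $a$ precedes $b$ on $T$ and $-1$ otherwise; $o_M=+1$ if $a$ precedes $c$ on $M$ and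 $-1$ otherwise; $o_B=+1$ if $b$ precedes $c$ on $B$ and $-1$ otherwise. If $o_M\varepsilon_a=o_B\varepsilon_b=o_T\varepsilon_a\varepsilon_b\varepsilon_c$, the move exchanges the two endpoints on each of the three arcs, keeping all signs and arrow directions. - PR1: add or delete a precrossing arrow (any direction) whose two endpoints lie consecutively on one arc. - PR2: there are two arcs, each containing exactly one endpoint of a classical arrow $x$ and one endpoint of a precrossing arrow $p$, where $x$ and $p$ point to different arcs if $x$ is positive and to the same arc if $x$ is negative. The move exchanges the two endpoints on each of the two arcs, keeps the sign of $x$, and reverses the directions of both $x$ and $p$ (so that each arrow now points to the arc it previously came from). - PR3: there are three arcs $T,X,Y$, a precrossing arrow $p$ from $X$ to $Y$, a classical arrow $a$ joining $T$ and $X$, and a classical arrow $b$ joining $T$ and $Y$, with signs $\varepsilon_a,\varepsilon_b$; either both $a,b$ have their tails on $T$ (put $\eta=1$), or both have their heads on $T$ (put $\eta=-1$). Put $o_T=+1$ if $a$ precedes $b$ on $T$ and $-1$ otherwise; $o_X=+1$ if $a$ precedes $p$ on $X$ and $-1$ otherwise; $o_Y=+1$ if $b$ precedes $p$ on $Y$ and $-1$ otherwise. If $\eta\, o_X\varepsilon_a=\eta\, o_Y\varepsilon_b=o_T\varepsilon_a\varepsilon_b$, the move exchanges the two endpoints on each of the three arcs, keeping signs and directions. A *virtual pseudoknot* is an equivalence class of pseudo-Gauss diagrams under the equivalence relation generated by these moves. **The map $\mathcal{I}$.** Let $\mathbb{Z}\mathcal{C}$ be the set of all chord diagrams (on an oriented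 circle, up to orientation-preserving homeomorphism) in which each chord is decorated with an integer. For a pseudo-Gauss diagram $P$, $\mathcal{I}(P)\in\mathbb{Z}\mathcal{C}$ is obtained as follows: 1. Replace with chords all arrows in $P$ that are associated to precrossings (i.e. delete all arrowheads on precrossing arrows). These chords are called *prechords*. 2. Decorate each prechord $c$ with the integer $i(c)$, the sum of the signs of the classical arrows that intersect $c$. 3. Delete all classical arrows. 4. Delete any prechords $c$ that have adjacent endpoints and $i(c)=0$.
   Formalization: Step 4 is repeated until no prechord with adjacent endpoints and i(c)=0 remains; with a single pass the claim fails: the all-precrossing diagrams ststpqqp and ststpp are related by PR1, but one pass leaves three chords in the first and two in the second. *)

theory Defs
  imports Main "HOL-Library.Multiset"
begin

text \<open>
  A diagram is recorded by a Gauss word: cut the circle at a point that is not an endpoint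
  of a chord and list the endpoints counterclockwise. The choice of the cut and of the chord names
  is factored out by \<open>pg_iso\<close> (rotation and injective renaming), which is the combinatorial form of
  an orientation-preserving homeomorphism of the circle.
\<close>

datatype endpoint = Tail | Head

fun opp :: "endpoint \<Rightarrow> endpoint" where
  "opp Tail = Head"
| "opp Head = Tail"

datatype arrow_kind = is_Classical: Classical (sign_of: int) | Precrossing

datatype pg_diagram =
  PG (pg_word: "(nat \<times> endpoint) list") (pg_kind: "nat \<Rightarrow> arrow_kind")

definition arrows :: "pg_diagram \<Rightarrow> nat set" where
  "arrows D = fst ` set (pg_word D)"

definition pseudo_gauss :: "pg_diagram \<Rightarrow> bool" where
  "pseudo_gauss D \<longleftrightarrow>
     distinct (pg_word D) \<and>
     (\<forall>c\<in>arrows D. (c, Tail) \<in> set (pg_word D) \<and> (c, Head) \<in> set (pg_word D)) \<and>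
     (\<forall>c\<in>arrows D. \<forall>\<epsilon>. pg_kind D c = Classical \<epsilon> \<longrightarrow> \<epsilon> = 1 \<or> \<epsilon> = - 1)"

definition pg_iso :: "pg_diagram \<Rightarrow> pg_diagram \<Rightarrow> bool" where
  "pg_iso D D' \<longleftrightarrow>
     (\<exists>f n. inj_on f (arrows D) \<and>
            pg_word D' = rotate n (map (\<lambda>(c, e). (f c, e)) (pg_word D)) \<and>
            (\<forall>c\<in>arrows D. pg_kind D' (f c) = pg_kind D c))"

text \<open>
  \<open>rewrite_arcs R w w'\<close>: the words \<open>w\<close> and \<open>w'\<close> agree except on disjoint arcs, one for each
  pair \<open>(x, y)\<close> in \<open>R\<close>, where \<open>w\<close> reads \<open>x\<close> and \<open>w'\<close> reads \<open>y\<close>. The arcs may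
  occur in any order around the circle. No arc contains the cut point; since diagrams may be
  rotated between moves, this is no restriction.
\<close>

inductive rewrite_arcs :: "('l list \<times> 'l list) multiset \<Rightarrow> 'l list \<Rightarrow> 'l list \<Rightarrow> bool" where
  rewrite_none: "rewrite_arcs {#} s s"
| rewrite_arc: "rewrite_arcs R w w' \<Longrightarrow>
    rewrite_arcs (add_mset (x, y) R) (s @ x @ w) (s @ y @ w')"

text \<open>An arc with endpoints \<open>x\<close> and \<open>y\<close>, where \<open>x\<close> precedes \<open>y\<close> iff \<open>o\<^sub>0 = 1\<close>.\<close>

definition arc :: "int \<Rightarrow> 'l \<Rightarrow> 'l \<Rightarrow> 'l list" where
  "arc o\<^sub>0 x y = (if o\<^sub>0 = 1 then [x, y] else [y, x])"

text \<open>
  Each rule lists one direction of a move. All moves leave the kinds of arrows alone, so both sides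
  share the function \<open>k\<close>; its value at a name that does not occur in the word is irrelevant, as
  \<open>pg_iso\<close> does not constrain it. That an added arrow has a new name, and that the arrows in a move
  are pairwise different, follows because both sides are required to be diagrams
  in \<open>pseudoknot_step\<close>.
\<close>

inductive pg_move :: "pg_diagram \<Rightarrow> pg_diagram \<Rightarrow> bool" where
  R1: "pg_move (PG w k) (PG w' k)"
  if "k c = Classical \<epsilon>"
    and "rewrite_arcs {# ([], [(c, e), (c, opp e)]) #} w w'"
| R2: "pg_move (PG w k) (PG w' k)"
  if "k a = Classical \<epsilon>" and "k b = Classical (- \<epsilon>)"
    and "o\<^sub>T \<in> {1, - 1}" and "o\<^sub>H \<in> {1, - 1}"
    and "rewrite_arcs {# ([], arc o\<^sub>T (a, Tail) (b, Tail)),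
                         ([], arc o\<^sub>H (a, Head) (b, Head)) #} w w'"
| R3: "pg_move (PG w k) (PG w' k)"
  if "k a = Classical \<epsilon>\<^sub>a" and "k b = Classical \<epsilon>\<^sub>b" and "k c = Classical \<epsilon>\<^sub>c"
    and "o\<^sub>T \<in> {1, - 1}" and "o\<^sub>M \<in> {1, - 1}" and "o\<^sub>B \<in> {1, - 1}"
    and "o\<^sub>M * \<epsilon>\<^sub>a = o\<^sub>B * \<epsilon>\<^sub>b" and "o\<^sub>B * \<epsilon>\<^sub>b = o\<^sub>T * \<epsilon>\<^sub>a * \<epsilon>\<^sub>b * \<epsilon>\<^sub>c"
    and "rewrite_arcs
          {# (arc o\<^sub>T (a, Tail) (b, Tail), arc (- o\<^sub>T) (a, Tail) (b, Tail)),
             (arc o\<^sub>M (a, Head) (c, Tail), arc (- o\<^sub>M) (a, Head) (c, Tail)),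
             (arc o\<^sub>B (b, Head) (c, Head), arc (- o\<^sub>B) (b, Head) (c, Head)) #} w w'"
| PR1: "pg_move (PG w k) (PG w' k)"
  if "k c = Precrossing"
    and "rewrite_arcs {# ([], [(c, e), (c, opp e)]) #} w w'"
| PR2: "pg_move (PG w k) (PG w' k)"
  \<comment> \<open>\<open>x\<close> and \<open>p\<close> point to the same arc iff their endpoints \<open>e\<close>, \<open>f\<close> on the first arc are equal.\<close>
  if "k x = Classical \<epsilon>" and "k p = Precrossing"
    and "\<epsilon> = 1 \<and> e \<noteq> f \<or> \<epsilon> = - 1 \<and> e = f"
    and "o\<^sub>1 \<in> {1, - 1}" and "o\<^sub>2 \<in> {1, - 1}"
    and "rewrite_arcs
          {# (arc o\<^sub>1 (x, e) (p, f), arc (- o\<^sub>1) (x, opp e) (p, opp f)),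
             (arc o\<^sub>2 (x, opp e) (p, opp f), arc (- o\<^sub>2) (x, e) (p, f)) #} w w'"
| PR3: "pg_move (PG w k) (PG w' k)"
  if "k p = Precrossing" and "k a = Classical \<epsilon>\<^sub>a" and "k b = Classical \<epsilon>\<^sub>b"
    and "t = Tail \<and> \<eta> = 1 \<or> t = Head \<and> \<eta> = - 1"
    and "o\<^sub>T \<in> {1, - 1}" and "o\<^sub>X \<in> {1, - 1}" and "o\<^sub>Y \<in> {1, - 1}"
    and "\<eta> * o\<^sub>X * \<epsilon>\<^sub>a = \<eta> * o\<^sub>Y * \<epsilon>\<^sub>b" and "\<eta> * o\<^sub>Y * \<epsilon>\<^sub>b = o\<^sub>T * \<epsilon>\<^sub>a * \<epsilon>\<^sub>b"
    and "rewrite_arcs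
          {# (arc o\<^sub>T (a, t) (b, t), arc (- o\<^sub>T) (a, t) (b, t)),
             (arc o\<^sub>X (a, opp t) (p, Tail), arc (- o\<^sub>X) (a, opp t) (p, Tail)),
             (arc o\<^sub>Y (b, opp t) (p, Head), arc (- o\<^sub>Y) (b, opp t) (p, Head)) #} w w'"

definition pseudoknot_step :: "pg_diagram \<Rightarrow> pg_diagram \<Rightarrow> bool" where
  "pseudoknot_step D D' \<longleftrightarrow> pseudo_gauss D \<and> pseudo_gauss D' \<and> (pg_iso D D' \<or> pg_move D D')"

definition same_virtual_pseudoknot :: "pg_diagram \<Rightarrow> pg_diagram \<Rightarrow> bool" where
  "same_virtual_pseudoknot = equivclp pseudoknot_step"

datatype zchord_word = ZW (zw_word: "nat list") (zw_dec: "nat \<Rightarrow> int")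

definition zchord_diagram :: "zchord_word \<Rightarrow> bool" where
  "zchord_diagram E \<longleftrightarrow> (\<forall>c\<in>set (zw_word E). count_list (zw_word E) c = 2)"

definition zw_iso :: "zchord_word \<Rightarrow> zchord_word \<Rightarrow> bool" where
  "zw_iso E E' \<longleftrightarrow>
     (\<exists>f n. inj_on f (set (zw_word E)) \<and>
            zw_word E' = rotate n (map f (zw_word E)) \<and>
            (\<forall>c\<in>set (zw_word E). zw_dec E' (f c) = zw_dec E c))"

definition same_zchord :: "zchord_word \<Rightarrow> zchord_word \<Rightarrow> bool" where
  "same_zchord E E' \<longleftrightarrow> zchord_diagram E \<and> zchord_diagram E' \<and> zw_iso E E'"

lemma zw_iso_refl: "zw_iso E E"
  unfolding zw_iso_def by (intro exI[of _ id] exI[of _ 0]) simp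

lemma zw_iso_sym:
  assumes "zw_iso E E'"
  shows "zw_iso E' E"
proof -
  obtain f n where f: "inj_on f (set (zw_word E))"
    and w: "zw_word E' = rotate n (map f (zw_word E))"
    and d: "\<forall>c\<in>set (zw_word E). zw_dec E' (f c) = zw_dec E c"
    using assms unfolding zw_iso_def by blast
  define g where "g = inv_into (set (zw_word E)) f"
  have gf: "g (f c) = c" if "c \<in> set (zw_word E)" for c
    using f that by (simp add: g_def)
  have set_w: "set (zw_word E') = f ` set (zw_word E)"
    by (simp add: w)
  define l where "l = length (zw_word E)"
  have inv: "map g (map f (zw_word E)) = zw_word E"
    by (simp add: map_idI gf)
  have *: "map g (zw_word E') = rotate n (zw_word E)"
    unfolding w rotate_map[symmetric] using inv by (simp add: rotate_map)
  have "rotate (l - n mod l) (rotate n (zw_word E)) = zw_word E"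
  proof (cases "l = 0")
    case False
    have "rotate (l - n mod l) (rotate n (zw_word E))
        = rotate (l - n mod l) (rotate (n mod l) (zw_word E))"
      by (simp add: l_def rotate_conv_mod[symmetric])
    also have "\<dots> = rotate l (zw_word E)"
      using False by (simp add: rotate_rotate less_imp_le)
    finally show ?thesis
      by (simp add: l_def)
  qed (simp add: l_def)
  then have "zw_word E = rotate (l - n mod l) (map g (zw_word E'))"
    using * by simp
  moreover have "inj_on g (set (zw_word E'))"
    unfolding set_w by (rule inj_onI) (auto simp: gf)
  moreover have "\<forall>c\<in>set (zw_word E'). zw_dec E (g c) = zw_dec E' c"
    unfolding set_w using d by (simp add: gf)
  ultimately show ?thesis
    unfolding zw_iso_def by blast
qed

lemma zw_iso_trans:
  assumes "zw_iso E E'" and "zw_iso E' E''"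
  shows "zw_iso E E''"
proof -
  obtain f n where f: "inj_on f (set (zw_word E))"
    and w: "zw_word E' = rotate n (map f (zw_word E))"
    and d: "\<forall>c\<in>set (zw_word E). zw_dec E' (f c) = zw_dec E c"
    using assms(1) unfolding zw_iso_def by blast
  obtain g m where g: "inj_on g (set (zw_word E'))"
    and w': "zw_word E'' = rotate m (map g (zw_word E'))"
    and d': "\<forall>c\<in>set (zw_word E'). zw_dec E'' (g c) = zw_dec E' c"
    using assms(2) unfolding zw_iso_def by blast
  have set_w: "set (zw_word E') = f ` set (zw_word E)"
    by (simp add: w)
  have "inj_on (g \<circ> f) (set (zw_word E))"
    using f g set_w by (simp add: comp_inj_on)
  moreover have "zw_word E'' = rotate (m + n) (map (g \<circ> f) (zw_word E))"
    by (simp add: w w' rotate_map[symmetric] rotate_rotate)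
  moreover have "\<forall>c\<in>set (zw_word E). zw_dec E'' ((g \<circ> f) c) = zw_dec E c"
    using d d' set_w by simp
  ultimately show ?thesis
    unfolding zw_iso_def by blast
qed

quotient_type ZC = zchord_word / partial: same_zchord
proof (rule part_equivpI)
  show "\<exists>E. same_zchord E E"
    by (rule exI[of _ "ZW [] (\<lambda>_. 0)"]) (simp add: same_zchord_def zchord_diagram_def zw_iso_refl)
  show "symp same_zchord"
    by (rule sympI) (auto simp: same_zchord_def intro: zw_iso_sym)
  show "transp same_zchord"
    by (rule transpI) (auto simp: same_zchord_def intro: zw_iso_trans)
qed

definition intersect :: "pg_diagram \<Rightarrow> nat \<Rightarrow> nat \<Rightarrow> bool" where
  "intersect D c d \<longleftrightarrow>
     filter (\<lambda>x. x = c \<or> x = d) (map fst (pg_word D)) \<in> {[c, d, c, d], [d, c, d, c]}"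

definition intersection_index :: "pg_diagram \<Rightarrow> nat \<Rightarrow> int" where
  "intersection_index D c =
     (\<Sum>a | a \<in> arrows D \<and> is_Classical (pg_kind D a) \<and> intersect D a c. sign_of (pg_kind D a))"

definition prechord_word :: "pg_diagram \<Rightarrow> zchord_word" where
  "prechord_word D =
     ZW (filter (\<lambda>c. pg_kind D c = Precrossing) (map fst (pg_word D))) (intersection_index D)"

definition adjacent_ends :: "zchord_word \<Rightarrow> nat \<Rightarrow> bool" where
  "adjacent_ends E c \<longleftrightarrow> (\<exists>n r. rotate n (zw_word E) = c # c # r)"

definition trivial_chord :: "zchord_word \<Rightarrow> nat \<Rightarrow> bool" where
  "trivial_chord E c \<longleftrightarrow> c \<in> set (zw_word E) \<and> adjacent_ends E c \<and> zw_dec E c = 0"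

text \<open>
  Deleting a chord can make the endpoints of another chord adjacent, so the deletion is repeated
  until no trivial chord is left. A single pass would not be invariant: it sends \<open>s t s t p q q p\<close>
  with all decorations zero to \<open>s t s t p p\<close>, but \<open>s t s t p p\<close>, obtained by removing \<open>q\<close>
  with \<open>PR1\<close>, to \<open>s t s t\<close>.
\<close>

function delete_trivial :: "zchord_word \<Rightarrow> zchord_word" where
  "delete_trivial E =
     (if \<exists>c. trivial_chord E c
      then delete_trivial (ZW (filter (\<lambda>c. \<not> trivial_chord E c) (zw_word E)) (zw_dec E))
      else E)"
  by pat_completeness auto
termination
proof (relation "measure (length \<circ> zw_word)")
  fix E
  assume "\<exists>c. trivial_chord E c"
  then have "\<exists>c\<in>set (zw_word E). trivial_chord E c"
    by (auto simp: trivial_chord_def)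
  then show "(ZW (filter (\<lambda>c. \<not> trivial_chord E c) (zw_word E)) (zw_dec E), E)
      \<in> measure (length \<circ> zw_word)"
    by (auto intro: length_filter_less)
qed simp

declare delete_trivial.simps [simp del]

definition I_map :: "pg_diagram \<Rightarrow> ZC" where
  "I_map D = abs_ZC (delete_trivial (prechord_word D))"

text \<open>The word passed to \<^term>\<open>abs_ZC\<close> does represent an element of \<^typ>\<open>ZC\<close>.\<close>

lemma zchord_diagram_filter:
  assumes "zchord_diagram (ZW w d)"
  shows "zchord_diagram (ZW (filter P w) d')"
proof -
  have "count_list (filter P w) c = count_list w c" if "P c" for c
    using that by (induction w) auto
  then show ?thesis
    using assms by (auto simp: zchord_diagram_def)
qed

lemma zchord_diagram_delete_trivial:
  "zchord_diagram E \<Longrightarrow> zchord_diagram (delete_trivial E)"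
proof (induction E rule: delete_trivial.induct)
  case (1 E)
  show ?case
  proof (cases "\<exists>c. trivial_chord E c")
    case True
    have "zchord_diagram (ZW (filter (\<lambda>c. \<not> trivial_chord E c) (zw_word E)) (zw_dec E))"
      by (rule zchord_diagram_filter[of _ "zw_dec E"]) (use "1.prems" in simp)
    then show ?thesis
      using "1.IH"[OF True] True by (subst delete_trivial.simps) simp
  next
    case False
    then have "delete_trivial E = E"
      using delete_trivial.simps[of E] by (simp only: if_False)
    then show ?thesis
      using "1.prems" by simp
  qed
qed

lemma zchord_diagram_prechord_word:
  assumes "pseudo_gauss D"
  shows "zchord_diagram (prechord_word D)"
proof -
  have "count_list (map fst (pg_word D)) c = 2" if "c \<in> arrows D" for c
  proof -
    have "count_list (map fst (pg_word D)) c
        = length (filter (\<lambda>x. fst x = c) (pg_word D))"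
      by (induction "pg_word D" rule: list.induct)
        (auto simp: count_list_eq_length_filter comp_def filter_map intro!: arg_cong[of _ _ length] filter_cong)
    also have "\<dots> = card {x \<in> set (pg_word D). fst x = c}"
      using assms by (simp add: pseudo_gauss_def distinct_length_filter Int_def conj_commute)
    also have "{x \<in> set (pg_word D). fst x = c} = {(c, Tail), (c, Head)}"
      using assms that by (auto simp: pseudo_gauss_def) (metis endpoint.exhaust)+
    finally show ?thesis
      by simp
  qed
  then have "zchord_diagram (ZW (map fst (pg_word D)) (intersection_index D))"
    by (auto simp: zchord_diagram_def arrows_def)
  then show ?thesis
    unfolding prechord_word_def by (rule zchord_diagram_filter)
qed

lemma same_zchord_I_map:
  assumes "pseudo_gauss D"
  shows "same_zchord (delete_trivial (prechord_word D)) (delete_trivial (prechord_word D))"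
  by (simp add: same_zchord_def zw_iso_refl zchord_diagram_delete_trivial
      zchord_diagram_prechord_word assms)

end

theory Submission imports Defs begin

text \<open>
  The invariant is built in two stages, and each absorbs a different part of the equivalence.

  The first stage keeps the prechords and their indices. No move apart from PR1 changes the cyclic
  word of precrossing endpoints, because each arc that takes part in such a move contains at most
  one of them. The indices are also kept. In R1 the new arrow crosses nothing; in R2 the two
  arrows have opposite signs and cross the same prechords; R3 moves no endpoint past an end of a
  precrossing; in PR2 the arrow \<open>x\<close> passes \<open>p\<close> twice, so the two cross after the move iff they
  crossed before. The delicate move is PR3: each of \<open>a\<close> and \<open>b\<close> begins or ceases to cross \<open>p\<close>, and
  the compatibility condition on the signs makes these two changes cancel
  (\<open>three_arcs_alternating\<close>, \<open>PR3_same_prechords\<close>).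

  The second stage, the repeated deletion of trivial chords, absorbs PR1. A precrossing with
  consecutive endpoints has index zero, so it is a trivial chord, and deleting some trivial chords
  ahead of time does not change the final result (\<open>delete_trivial_delete_chords\<close>), because a
  trivial chord stays trivial when others are deleted. Since the deletion also commutes with
  rotation and renaming (\<open>zw_iso_delete_trivial\<close>), each single step preserves \<open>I_map\<close>.

  To compare diagrams before and after a move, the words are projected to the two or three chords
  of interest. A filter is a monoid homomorphism, so it carries the rewriting of arcs in the whole
  word to a rewriting of the projected word (\<open>rewrite_arcs_hom\<close>), where most arcs become trivial.
  In the remaining cases, PR2 and PR3, the projected word consists of the displayed arcs alone
  (\<open>rewrite_arcs_exact\<close>), which leaves finitely many words to inspect.
\<close>

section \<open>Rotations of words\<close>

lemma filter_rotate:
  obtains m where "filter P (rotate n u) = rotate m (filter P u)"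
proof -
  let ?k = "n mod length u"
  have "filter P (rotate n u) = filter P (drop ?k u) @ filter P (take ?k u)"
    by (simp add: rotate_drop_take)
  also have "\<dots> = rotate (length (filter P (take ?k u))) (filter P (take ?k u) @ filter P (drop ?k u))"
    by (simp only: rotate_append)
  also have "filter P (take ?k u) @ filter P (drop ?k u) = filter P u"
    by (simp only: filter_append[symmetric] append_take_drop_id)
  finally show ?thesis
    using that by blast
qed

lemma rotate_inverse:
  obtains m where "rotate m (rotate n u) = u"
proof -
  let ?k = "n mod length u"
  have "rotate (length u - ?k) (rotate n u) = rotate (length u - ?k) (drop ?k u @ take ?k u)"
    by (simp add: rotate_drop_take)
  also have "\<dots> = u"
    using rotate_append[of "drop ?k u" "take ?k u"] by simp
  finally show ?thesis
    using that by blast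
qed

section \<open>Reduction of decorated chord diagrams\<close>

definition delete_chords :: "nat set \<Rightarrow> zchord_word \<Rightarrow> zchord_word" where
  "delete_chords S E = ZW (filter (\<lambda>c. c \<notin> S) (zw_word E)) (zw_dec E)"

lemma delete_trivial_step: "delete_trivial (delete_chords {c. trivial_chord E c} E) = delete_trivial E"
proof (cases "\<exists>c. trivial_chord E c")
  case True
  then show ?thesis
    by (subst (2) delete_trivial.simps) (simp add: delete_chords_def)
next
  case False
  then show ?thesis
    by (simp add: delete_chords_def)
qed

text \<open>
  Deleting letters cannot separate two neighbours that survive. This monotonicity is what makes
  the deletion process confluent.
\<close>

lemma trivial_chord_delete_chords:
  assumes "trivial_chord E c" and "c \<notin> S"
  shows "trivial_chord (delete_chords S E) c"
proof -
  obtain n r where n: "rotate n (zw_word E) = c # c # r"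
    using assms(1) by (auto simp: trivial_chord_def adjacent_ends_def)
  obtain m where "filter (\<lambda>c. c \<notin> S) (rotate n (zw_word E))
      = rotate m (filter (\<lambda>c. c \<notin> S) (zw_word E))"
    by (rule filter_rotate)
  then have "rotate m (zw_word (delete_chords S E)) = c # c # filter (\<lambda>c. c \<notin> S) r"
    using n assms(2) by (simp add: delete_chords_def)
  then show ?thesis
    using assms by (auto simp: trivial_chord_def adjacent_ends_def delete_chords_def)
qed

text \<open>
  Confluence: after the chords in \<open>S\<close> are gone, the other trivial chords of \<open>E\<close> are still
  trivial, and deleting them as well gives the word that one round of the deletion makes from \<open>E\<close>.
\<close>

lemma delete_trivial_delete_chords:
  assumes "\<And>c. c \<in> S \<Longrightarrow> trivial_chord E c"
  shows "delete_trivial (delete_chords S E) = delete_trivial E"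
  using assms
proof (induction "length (zw_word E)" arbitrary: E S rule: less_induct)
  case less
  let ?T = "{c. trivial_chord E c}"
  show ?case
  proof (cases "S = {}")
    case True
    then show ?thesis
      by (simp add: delete_chords_def)
  next
    case False
    then obtain c where "c \<in> S" "c \<in> set (zw_word E)"
      using less.prems by (auto simp: trivial_chord_def)
    then have shorter: "length (zw_word (delete_chords S E)) < length (zw_word E)"
      by (auto simp: delete_chords_def intro: length_filter_less)
    have "delete_chords (?T - S) (delete_chords S E) = delete_chords ?T E"
      using less.prems by (auto simp: delete_chords_def intro!: filter_cong)
    then have "delete_trivial (delete_chords S E) = delete_trivial (delete_chords ?T E)"
      using less.hyps[OF shorter, of "?T - S"] by (simp add: trivial_chord_delete_chords)
    then show ?thesis
      by (simp only: delete_trivial_step)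
  qed
qed

lemma trivial_chord_iso:
  assumes f: "inj_on f (set (zw_word E))"
    and w: "zw_word E' = rotate n (map f (zw_word E))"
    and d: "\<forall>c\<in>set (zw_word E). zw_dec E' (f c) = zw_dec E c"
    and c: "c \<in> set (zw_word E)"
  shows "trivial_chord E' (f c) \<longleftrightarrow> trivial_chord E c"
proof -
  have "adjacent_ends E' (f c) \<longleftrightarrow> adjacent_ends E c"
  proof
    assume "adjacent_ends E' (f c)"
    then obtain m r where "rotate m (zw_word E') = f c # f c # r"
      by (auto simp: adjacent_ends_def)
    then have "map f (rotate (m + n) (zw_word E)) = f c # f c # r"
      by (simp add: w rotate_rotate rotate_map)
    then obtain x y r' where r: "rotate (m + n) (zw_word E) = x # y # r'" and eq: "f x = f c" "f y = f c"
      by (auto simp: map_eq_Cons_conv)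
    then have "x \<in> set (zw_word E)" "y \<in> set (zw_word E)"
      by (metis list.set_intros set_rotate)+
    then have "x = c" "y = c"
      using f c eq by (auto dest: inj_onD)
    then show "adjacent_ends E c"
      using r by (auto simp: adjacent_ends_def)
  next
    assume "adjacent_ends E c"
    then obtain m r where m: "rotate m (zw_word E) = c # c # r"
      by (auto simp: adjacent_ends_def)
    obtain k where k: "rotate k (rotate n (map f (zw_word E))) = map f (zw_word E)"
      by (rule rotate_inverse)
    have "rotate (m + k) (zw_word E') = rotate m (rotate k (rotate n (map f (zw_word E))))"
      by (simp only: w rotate_rotate add.assoc)
    also have "\<dots> = f c # f c # map f r"
      unfolding k by (simp only: rotate_map m list.map)
    finally show "adjacent_ends E' (f c)"
      by (auto simp: adjacent_ends_def)
  qed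
  then show ?thesis
    using w d c by (simp add: trivial_chord_def)
qed

text \<open>
  Triviality of a chord is invariant under rotation and renaming, so isomorphic words lose
  corresponding chords in every round.
\<close>

lemma zw_iso_delete_trivial:
  assumes "zw_iso E E'"
  shows "zw_iso (delete_trivial E) (delete_trivial E')"
  using assms
proof (induction "length (zw_word E)" arbitrary: E E' rule: less_induct)
  case less
  obtain f n where f: "inj_on f (set (zw_word E))"
    and w: "zw_word E' = rotate n (map f (zw_word E))"
    and d: "\<forall>c\<in>set (zw_word E). zw_dec E' (f c) = zw_dec E c"
    using less.prems unfolding zw_iso_def by blast
  have triv: "trivial_chord E' (f c) \<longleftrightarrow> trivial_chord E c" if "c \<in> set (zw_word E)" for c
    using trivial_chord_iso[OF f w d that] .
  let ?F = "delete_chords {c. trivial_chord E c} E"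
  let ?F' = "delete_chords {c. trivial_chord E' c} E'"
  show ?case
  proof (cases "\<exists>c. trivial_chord E c")
    case True
    then obtain c where "trivial_chord E c" "c \<in> set (zw_word E)"
      by (auto simp: trivial_chord_def)
    then have shorter: "length (zw_word ?F) < length (zw_word E)"
      by (auto simp: delete_chords_def intro: length_filter_less)
    obtain m where "zw_word ?F' = rotate m (filter (\<lambda>c. \<not> trivial_chord E' c) (map f (zw_word E)))"
      by (rule filter_rotate[of "\<lambda>c. \<not> trivial_chord E' c" n "map f (zw_word E)"])
        (simp add: delete_chords_def w)
    also have "filter (\<lambda>c. \<not> trivial_chord E' c) (map f (zw_word E)) = map f (zw_word ?F)"
      using triv by (auto simp: delete_chords_def filter_map intro!: arg_cong[of _ _ "map f"] filter_cong)
    finally have "zw_iso ?F ?F'"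
      using f d unfolding zw_iso_def
      by (intro exI[of _ f] exI[of _ m]) (auto simp: delete_chords_def intro: inj_on_subset)
    from less.hyps[OF shorter this] show ?thesis
      by (simp only: delete_trivial_step)
  next
    case False
    have "\<not> (\<exists>c'. trivial_chord E' c')"
    proof
      assume "\<exists>c'. trivial_chord E' c'"
      then obtain c' where t: "trivial_chord E' c'" ..
      then obtain c where "c \<in> set (zw_word E)" "c' = f c"
        by (auto simp: trivial_chord_def w)
      then show False
        using t triv False by blast
    qed
    then have "delete_trivial E' = E'"
      using delete_trivial.simps[of E'] by (simp only: if_False)
    moreover have "delete_trivial E = E"
      using False delete_trivial.simps[of E] by (simp only: if_False)
    ultimately show ?thesis
      using less.prems by simp
  qed
qed

section \<open>Alternating chords and intersection indices\<close>

text \<open>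
  Intersection of chords depends only on the word of their names; separating it from diagrams lets
  it be evaluated on projected words, and the pattern is symmetric under cyclic rotation.
\<close>

definition alternating :: "'a \<Rightarrow> 'a \<Rightarrow> 'a list \<Rightarrow> bool" where
  "alternating c d u \<longleftrightarrow> filter (\<lambda>x. x = c \<or> x = d) u \<in> {[c, d, c, d], [d, c, d, c]}"

abbreviation chord_names :: "pg_diagram \<Rightarrow> nat list" where
  "chord_names D \<equiv> map fst (pg_word D)"

lemma intersect_alternating: "intersect D c d \<longleftrightarrow> alternating c d (chord_names D)"
  by (simp add: intersect_def alternating_def)

lemma alternating_mem:
  assumes "alternating c d u"
  shows "c \<in> set u"
proof -
  have "filter (\<lambda>x. x = c \<or> x = d) u = [c, d, c, d] \<or> filter (\<lambda>x. x = c \<or> x = d) u = [d, c, d, c]"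
    using assms by (simp add: alternating_def)
  then have "c \<in> set (filter (\<lambda>x. x = c \<or> x = d) u)"
    by (metis list.set_intros)
  then show ?thesis
    by simp
qed

lemma alternating_commute: "alternating c d u \<longleftrightarrow> alternating d c u"
  by (auto simp: alternating_def disj_commute)

lemma alternating_rotate_imp:
  assumes "alternating c d u"
  shows "alternating c d (rotate n u)"
proof -
  obtain m where m: "filter (\<lambda>x. x = c \<or> x = d) (rotate n u)
      = rotate m (filter (\<lambda>x. x = c \<or> x = d) u)"
    by (rule filter_rotate)
  have step: "rotate1 v \<in> {[c, d, c, d], [d, c, d, c]}" if "v \<in> {[c, d, c, d], [d, c, d, c]}" for v
    using that by auto
  have "rotate m v \<in> {[c, d, c, d], [d, c, d, c]}" if "v \<in> {[c, d, c, d], [d, c, d, c]}" for v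
  proof (induction m)
    case (Suc m)
    show ?case
      unfolding rotate_Suc by (rule step[OF Suc])
  qed (use that in simp)
  then show ?thesis
    using assms m by (simp only: alternating_def)
qed

lemma alternating_rotate: "alternating c d (rotate n u) \<longleftrightarrow> alternating c d u"
proof -
  obtain m where "rotate m (rotate n u) = u"
    by (rule rotate_inverse)
  then show ?thesis
    using alternating_rotate_imp by metis
qed

lemma alternating_map:
  assumes f: "inj_on f (insert c (insert d (set u)))"
  shows "alternating (f c) (f d) (map f u) \<longleftrightarrow> alternating c d u"
proof -
  let ?v = "filter (\<lambda>x. x = c \<or> x = d) u"
  have "f x = f c \<longleftrightarrow> x = c" "f x = f d \<longleftrightarrow> x = d" if "x \<in> set u" for x
    using that by (simp_all add: inj_on_eq_iff[OF f])
  then have "filter (\<lambda>x. x = f c \<or> x = f d) (map f u) = map f ?v"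
    by (auto simp: filter_map intro!: arg_cong[of _ _ "map f"] filter_cong)
  moreover have "map f ?v = map f s \<longleftrightarrow> ?v = s" if "set s \<subseteq> {c, d}" for s
    using that by (intro inj_on_map_eq_map inj_on_subset[OF f]) auto
  from this[of "[c, d, c, d]"] this[of "[d, c, d, c]"]
  have "map f ?v \<in> {[f c, f d, f c, f d], [f d, f c, f d, f c]}
      \<longleftrightarrow> ?v \<in> {[c, d, c, d], [d, c, d, c]}"
    by simp
  ultimately show ?thesis
    by (simp only: alternating_def)
qed

lemma alternating_filter:
  assumes "P c" and "P d"
  shows "alternating c d (filter P u) \<longleftrightarrow> alternating c d u"
proof -
  have "filter (\<lambda>x. x = c \<or> x = d) (filter P u) = filter (\<lambda>x. x = c \<or> x = d) u"
    using assms by (auto simp: filter_filter intro: filter_cong)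
  then show ?thesis
    by (simp add: alternating_def)
qed

text \<open>
  This is why arrows created by R1 contribute to no index and prechords created by PR1 have index
  zero.
\<close>

lemma not_alternating_adjacent:
  assumes "c \<noteq> d"
  shows "\<not> alternating c d (s @ [c, c] @ t)"
  using assms by (auto simp: alternating_def append_eq_Cons_conv Cons_eq_append_conv)

text \<open>
  With weight zero for precrossings, an index becomes a sum over any finite set that contains all
  arrows, so two diagrams with different arrows can be summed over the same set.
\<close>

definition weight :: "arrow_kind \<Rightarrow> int" where
  "weight \<kappa> = (if is_Classical \<kappa> then sign_of \<kappa> else 0)"

lemma weight_simps [simp]: "weight (Classical \<epsilon>) = \<epsilon>" "weight Precrossing = 0"
  by (simp_all add: weight_def)

lemma intersection_index_sum:
  assumes "finite C" and "arrows D \<subseteq> C"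
  shows "intersection_index D q = (\<Sum>a\<in>C. weight (pg_kind D a) * of_bool (intersect D a q))"
proof -
  have mem: "a \<in> arrows D" if "intersect D a q" for a
    using alternating_mem that by (fastforce simp: intersect_alternating arrows_def)
  have "intersection_index D q
      = (\<Sum>a | a \<in> arrows D \<and> is_Classical (pg_kind D a) \<and> intersect D a q.
          weight (pg_kind D a) * of_bool (intersect D a q))"
    unfolding intersection_index_def by (rule sum.cong) (auto simp: weight_def)
  also have "\<dots> = (\<Sum>a\<in>C. weight (pg_kind D a) * of_bool (intersect D a q))"
    using assms mem by (intro sum.mono_neutral_left) (auto simp: weight_def)
  finally show ?thesis .
qed

text \<open>
  In each move, \<open>S\<close> is the set of those classical arrows whose crossings with \<open>q\<close> may change; the
  comparison of indices is thereby reduced to at most two summands.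
\<close>

lemma intersection_index_eqI:
  assumes "finite S"
    and outside: "\<And>a. a \<notin> S \<Longrightarrow> is_Classical (k a)
      \<Longrightarrow> alternating a q (map fst w) \<longleftrightarrow> alternating a q (map fst w')"
    and inside: "(\<Sum>a\<in>S. weight (k a) * of_bool (alternating a q (map fst w)))
      = (\<Sum>a\<in>S. weight (k a) * of_bool (alternating a q (map fst w')))"
  shows "intersection_index (PG w k) q = intersection_index (PG w' k) q"
proof -
  define C where "C = S \<union> arrows (PG w k) \<union> arrows (PG w' k)"
  have C: "finite C" "arrows (PG w k) \<subseteq> C" "arrows (PG w' k) \<subseteq> C" "S \<subseteq> C"
    using assms(1) by (auto simp: C_def arrows_def)
  let ?s = "\<lambda>v a. weight (k a) * of_bool (alternating a q (map fst v)) :: int"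
  have "sum (?s w) (C - S) = sum (?s w') (C - S)"
    using outside by (intro sum.cong) (auto simp: weight_def)
  then have "sum (?s w) C = sum (?s w') C"
    using inside by (simp only: sum.subset_diff[OF C(4,1)])
  then show ?thesis
    using C by (simp add: intersection_index_sum[of C] intersect_alternating)
qed

lemma count_chord_names:
  assumes "pseudo_gauss D" and "c \<in> arrows D"
  shows "count_list (chord_names D) c = 2"
proof -
  \<comment> \<open>If all arrows are declared precrossings, every chord of \<open>D\<close> is a prechord.\<close>
  have "zchord_diagram (prechord_word (PG (pg_word D) (\<lambda>_. Precrossing)))"
    using assms by (intro zchord_diagram_prechord_word) (simp add: pseudo_gauss_def arrows_def)
  then show ?thesis
    using assms(2) by (auto simp: zchord_diagram_def prechord_word_def arrows_def)
qed

lemma length_filter_chord_names: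
  assumes "pseudo_gauss D" and "finite S" and "S \<subseteq> arrows D"
  shows "length (filter (\<lambda>x. x \<in> S) (chord_names D)) = 2 * card S"
  using assms(2,3)
proof (induction S rule: finite_induct)
  case (insert c S)
  have "length (filter (\<lambda>x. x \<in> insert c S) u) = count_list u c + length (filter (\<lambda>x. x \<in> S) u)" for u
    using insert.hyps by (induction u) auto
  then show ?case
    using insert count_chord_names[OF assms(1), of c] by simp
qed simp

section \<open>Rewriting on arcs\<close>

text \<open>
  Used for the projections \<open>h\<close> to the names in a fixed set; arcs rewrite independently of what
  lies between them, so the projected words are related by the projected rules.
\<close>

lemma rewrite_arcs_hom:
  assumes "rewrite_arcs R w w'" and "\<And>u v. h (u @ v) = h u @ h v"
  shows "rewrite_arcs (image_mset (map_prod h h) R) (h w) (h w')"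
  using assms(1) by induction (auto simp: assms(2) intro: rewrite_arcs.intros)

lemma rewrite_arcs_hom_eq:
  assumes "rewrite_arcs R w w'" and "\<And>u v. h (u @ v) = h u @ h v"
    and "\<forall>(x, y)\<in>#R. h x = h y"
  shows "h w = h w'"
  using assms(1,3) by induction (auto simp: assms(2))

text \<open>
  Two homomorphisms that agree on the old letters and on every inserted arc agree on the new word.
  With one of them composed with a transposition, this shows for R2 that the two new arrows
  occupy the same positions relative to every other chord.
\<close>

lemma rewrite_arcs_two_homs_eq:
  assumes "rewrite_arcs R w w'"
    and "\<And>u v. g (u @ v) = g u @ g v" and "\<And>u v. h (u @ v) = h u @ h v"
    and "\<forall>(x, y)\<in>#R. g y = h y"
    and "\<And>u. set u \<subseteq> set w \<Longrightarrow> g u = h u"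
  shows "g w' = h w'"
  using assms(1,4,5) by induction (auto simp: assms(2,3))

lemma rewrite_arcs_mset:
  assumes "rewrite_arcs R w w'"
  shows "mset w + (\<Sum>(x, y)\<in>#R. mset y) = mset w' + (\<Sum>(x, y)\<in>#R. mset x)"
  using assms by induction (auto simp: ac_simps)

lemma rewrite_arcs_factor:
  assumes "rewrite_arcs R w w'" and "(x, y) \<in># R"
  obtains s t s' t' where "w = s @ x @ t" and "w' = s' @ y @ t'"
proof -
  have "\<exists>s t s' t'. w = s @ x @ t \<and> w' = s' @ y @ t'"
    using assms
  proof induction
    case (rewrite_arc R w w' x\<^sub>1 y\<^sub>1 s)
    show ?case
    proof (cases "(x, y) \<in># R")
      case True
      then obtain u t u' t' where "w = u @ x @ t" "w' = u' @ y @ t'"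
        using rewrite_arc.IH by blast
      then show ?thesis
        by (intro exI[of _ "s @ x\<^sub>1 @ u"] exI[of _ t] exI[of _ "s @ y\<^sub>1 @ u'"] exI[of _ t']) simp
    next
      case False
      then show ?thesis
        using rewrite_arc.prems by auto
    qed
  qed simp
  then show ?thesis
    using that by blast
qed

text \<open>
  If the left-hand sides account for the whole length of \<open>w\<close>, there is no room for letters between
  the arcs, so both words are concatenations of arcs in one common order.
\<close>

lemma rewrite_arcs_exact:
  assumes "rewrite_arcs R w w'" and "length w = (\<Sum>r\<in>#R. length (fst r))"
  obtains L where "mset L = R" and "w = concat (map fst L)" and "w' = concat (map snd L)"
proof -
  have "(\<Sum>r\<in>#R. length (fst r)) \<le> length w
    \<and> (length w = (\<Sum>r\<in>#R. length (fst r))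
        \<longrightarrow> (\<exists>L. mset L = R \<and> w = concat (map fst L) \<and> w' = concat (map snd L)))"
    using assms(1)
  proof induction
    case (rewrite_none s)
    then show ?case by auto
  next
    case (rewrite_arc R w w' x y s)
    show ?case
    proof (intro conjI impI)
      show "(\<Sum>r\<in>#add_mset (x, y) R. length (fst r)) \<le> length (s @ x @ w)"
        using rewrite_arc.IH by simp
    next
      assume "length (s @ x @ w) = (\<Sum>r\<in>#add_mset (x, y) R. length (fst r))"
      then have "length s + length w = (\<Sum>r\<in>#R. length (fst r))"
        by simp
      moreover have "length s = 0"
        using calculation conjunct1[OF rewrite_arc.IH] by linarith
      ultimately have "s = []" "length w = (\<Sum>r\<in>#R. length (fst r))"
        by simp_all
      then obtain L where "mset L = R" "w = concat (map fst L)" "w' = concat (map snd L)"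
        using rewrite_arc.IH by blast
      then show "\<exists>L. mset L = add_mset (x, y) R \<and> s @ x @ w = concat (map fst L)
          \<and> s @ y @ w' = concat (map snd L)"
        using \<open>s = []\<close> by (intro exI[of _ "(x, y) # L"]) simp
    qed
  qed
  then show ?thesis
    using assms(2) that by blast
qed

lemma mset_eq_two_iff: "mset L = {#a, b#} \<longleftrightarrow> L = [a, b] \<or> L = [b, a]"
proof
  assume *: "mset L = {#a, b#}"
  then have "length L = 2"
    by (metis size_mset size_add_mset size_empty numeral_2_eq_2)
  then obtain x y where "L = [x, y]"
    by (auto simp: length_Suc_conv numeral_2_eq_2)
  then show "L = [a, b] \<or> L = [b, a]"
    using * by (auto simp: add_eq_conv_ex)
qed auto

lemma mset_eq_three:
  assumes "mset L = {#a, b, c#}"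
  shows "L \<in> {[a, b, c], [a, c, b], [b, a, c], [b, c, a], [c, a, b], [c, b, a]}"
proof -
  obtain x M where L: "L = x # M"
    using assms by (cases L) auto
  then have "x \<in># {#a, b, c#}"
    using assms by (metis list.set_intros(1) set_mset_mset)
  then consider "x = a" | "x = b" | "x = c"
    by auto
  then show ?thesis
  proof cases
    case 1
    then have "mset M = {#b, c#}"
      using assms L by simp
    then show ?thesis
      using 1 L by (auto simp: mset_eq_two_iff)
  next
    case 2
    then have "mset M = {#a, c#}"
      using assms L by (simp add: add_mset_commute)
    then show ?thesis
      using 2 L by (auto simp: mset_eq_two_iff)
  next
    case 3
    then have "mset M = {#a, b#}"
      using assms L by (simp add: add_mset_commute)
    then show ?thesis
      using 3 L by (auto simp: mset_eq_two_iff)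
  qed
qed

lemma map_arc [simp]: "map f (arc o\<^sub>0 x y) = arc o\<^sub>0 (f x) (f y)"
  by (simp add: arc_def)

lemma set_arc [simp]: "set (arc o\<^sub>0 x y) = {x, y}"
  by (auto simp: arc_def)

text \<open>
  The order of the two endpoints on an arc is invisible to a projection that forgets one of them.
\<close>

lemma filter_arc_eq:
  assumes "P x \<Longrightarrow> P y \<Longrightarrow> x = y"
  shows "filter P (arc o\<^sub>0 x y) = filter P (arc o\<^sub>1 x y)"
  using assms by (auto simp: arc_def)

section \<open>Invariance under the moves\<close>

definition same_prechords :: "pg_diagram \<Rightarrow> pg_diagram \<Rightarrow> bool" where
  "same_prechords D D' \<longleftrightarrow>
     zw_word (prechord_word D) = zw_word (prechord_word D') \<and>
     (\<forall>q\<in>set (zw_word (prechord_word D)). intersection_index D q = intersection_index D' q)"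

lemma zw_dec_prechord_word: "zw_dec (prechord_word D) = intersection_index D"
  by (simp add: prechord_word_def)

lemma same_prechords_zw_iso:
  "same_prechords D D' \<Longrightarrow> zw_iso (prechord_word D) (prechord_word D')"
  unfolding zw_iso_def by (intro exI[of _ id] exI[of _ 0]) (simp add: same_prechords_def zw_dec_prechord_word)

lemma zw_word_prechord_PG:
  "zw_word (prechord_word (PG w k)) = filter (\<lambda>c. k c = Precrossing) (map fst w)"
  by (simp add: prechord_word_def)

lemma same_prechordsI:
  assumes rw: "rewrite_arcs R w w'"
    and prechords: "\<forall>(x, y)\<in>#R. filter (\<lambda>c. k c = Precrossing) (map fst x)
        = filter (\<lambda>c. k c = Precrossing) (map fst y)"
    and index: "\<And>q. k q = Precrossing \<Longrightarrow> q \<in> fst ` set w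
        \<Longrightarrow> intersection_index (PG w k) q = intersection_index (PG w' k) q"
  shows "same_prechords (PG w k) (PG w' k)"
proof -
  have "filter (\<lambda>c. k c = Precrossing) (map fst w) = filter (\<lambda>c. k c = Precrossing) (map fst w')"
    using rewrite_arcs_hom_eq[OF rw, of "\<lambda>u. filter (\<lambda>c. k c = Precrossing) (map fst u)"] prechords
    by simp
  then have "zw_word (prechord_word (PG w k)) = zw_word (prechord_word (PG w' k))"
    by (simp add: zw_word_prechord_PG)
  moreover have "\<forall>q\<in>set (zw_word (prechord_word (PG w k))).
      intersection_index (PG w k) q = intersection_index (PG w' k) q"
    using index by (auto simp: zw_word_prechord_PG)
  ultimately show ?thesis
    by (simp only: same_prechords_def)
qed

lemma rewrite_arcs_alternating_eq:
  assumes rw: "rewrite_arcs R w w'"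
    and "\<forall>(x, y)\<in>#R. filter (\<lambda>c. c = a \<or> c = q) (map fst x) = filter (\<lambda>c. c = a \<or> c = q) (map fst y)"
  shows "alternating a q (map fst w) \<longleftrightarrow> alternating a q (map fst w')"
  unfolding alternating_def
  using rewrite_arcs_hom_eq[OF rw, of "\<lambda>u. filter (\<lambda>c. c = a \<or> c = q) (map fst u)"] assms(2) by simp

text \<open>
  A diagram contains both ends of any of its arrows, so an arrow that was already present would
  occur with a repeated endpoint after an insertion.
\<close>

lemma inserted_arrows_fresh:
  assumes "pseudo_gauss (PG w k)" and "pseudo_gauss (PG w' k)"
    and rw: "rewrite_arcs R w w'" and ins: "\<forall>(x, y)\<in>#R. x = []"
    and y: "(x, y) \<in># R" "(c, e) \<in> set y"
  shows "c \<notin> fst ` set w"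
proof
  assume "c \<in> fst ` set w"
  then have "(c, e) \<in> set w"
    using assms(1) by (cases e) (auto simp: pseudo_gauss_def arrows_def)
  have "(\<Sum>(x, y)\<in>#R. mset x) = {#}"
    using ins by (intro sum_mset.neutral) auto
  then have w': "mset w' = mset w + (\<Sum>(x, y)\<in>#R. mset y)"
    using rewrite_arcs_mset[OF rw] by simp
  moreover have "mset y \<subseteq># (\<Sum>(x, y)\<in>#R. mset y)"
    using y(1) by (auto dest!: multi_member_split)
  then have "count (mset y) (c, e) \<le> count (\<Sum>(x, y)\<in>#R. mset y) (c, e)"
    by (rule mset_subset_eq_count)
  moreover have "count (mset y) (c, e) > 0"
    using y(2) by simp
  moreover have "count (mset w) (c, e) > 0"
    using \<open>(c, e) \<in> set w\<close> by simp
  moreover have "count (mset w') (c, e) = count (mset w) (c, e) + count (\<Sum>(x, y)\<in>#R. mset y) (c, e)"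
    using w' by simp
  ultimately have "count (mset w') (c, e) \<ge> 2"
    by linarith
  moreover have "distinct w'"
    using assms(2) by (simp add: pseudo_gauss_def)
  ultimately show False
    by (simp add: distinct_count_atmost_1 split: if_splits)
qed

lemma alternating_not_mem: "c \<notin> set u \<Longrightarrow> \<not> alternating c d u"
  using alternating_mem by metis

lemma insert_one_arrow:
  assumes rw: "rewrite_arcs {#([], [(c, e), (c, e')])#} w w'"
  obtains s t where "w = s @ t" and "w' = s @ [(c, e), (c, e')] @ t"
proof -
  from rw show ?thesis
  proof cases
    case (rewrite_arc R v v' x y s)
    then have "R = {#}" "x = []" "y = [(c, e), (c, e')]"
      by (auto simp: add_mset_eq_single)
    moreover have "v = v'"
      using rewrite_arc(4) unfolding \<open>R = {#}\<close> by cases auto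
    ultimately show ?thesis
      using rewrite_arc that by auto
  qed simp
qed

lemma R1_same_prechords:
  assumes "pseudo_gauss (PG w k)" and "pseudo_gauss (PG w' k)"
    and c: "k c = Classical \<epsilon>"
    and rw: "rewrite_arcs {#([], [(c, e), (c, e')])#} w w'"
  shows "same_prechords (PG w k) (PG w' k)"
proof (rule same_prechordsI[OF rw])
  fix q
  assume q: "k q = Precrossing"
  then have "c \<noteq> q"
    using c by auto
  obtain s t where w': "w' = s @ [(c, e), (c, e')] @ t"
    using insert_one_arrow[OF rw] by metis
  have "c \<notin> fst ` set w"
    by (rule inserted_arrows_fresh[OF assms(1,2) rw, of _ _ _ e]) auto
  then have "\<not> alternating c q (map fst w)"
    by (intro alternating_not_mem) simp
  moreover have "\<not> alternating c q (map fst w')"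
    using not_alternating_adjacent[OF \<open>c \<noteq> q\<close>, of "map fst s" "map fst t"] by (simp add: w')
  ultimately show "intersection_index (PG w k) q = intersection_index (PG w' k) q"
    using \<open>c \<noteq> q\<close>
    by (intro intersection_index_eqI[of "{c}"] rewrite_arcs_alternating_eq[OF rw]) auto
qed (use c in auto)

lemma R2_same_prechords:
  assumes "pseudo_gauss (PG w k)" and "pseudo_gauss (PG w' k)"
    and a: "k a = Classical \<epsilon>" and b: "k b = Classical (- \<epsilon>)"
    and rw: "rewrite_arcs {#([], arc o\<^sub>T (a, Tail) (b, Tail)), ([], arc o\<^sub>H (a, Head) (b, Head))#} w w'"
  shows "same_prechords (PG w k) (PG w' k)"
proof (rule same_prechordsI[OF rw])
  fix q
  assume q: "k q = Precrossing"
  then have neq: "a \<noteq> q" "b \<noteq> q"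
    using a b by auto
  have fresh: "a \<notin> fst ` set w" "b \<notin> fst ` set w"
    by (rule inserted_arrows_fresh[OF assms(1,2) rw, of "[]" "arc o\<^sub>T (a, Tail) (b, Tail)" _ Tail]; auto)+
  have "(a, Tail) \<noteq> (b, Tail)"
  proof -
    obtain s t where "w' = s @ arc o\<^sub>T (a, Tail) (b, Tail) @ t"
      by (rule rewrite_arcs_factor[OF rw, of "[]" "arc o\<^sub>T (a, Tail) (b, Tail)"]) auto
    then show ?thesis
      using assms(2) by (auto simp: pseudo_gauss_def arc_def split: if_splits)
  qed
  then have "a \<noteq> b"
    by simp
  \<comment> \<open>Exchanging the names of the new arrows changes nothing that \<open>q\<close> can detect.\<close>
  define \<tau> where "\<tau> = id(a := b, b := a)"
  have \<tau>: "inj \<tau>" "\<tau> a = b" "\<tau> q = q" "\<And>x. x \<noteq> a \<Longrightarrow> x \<noteq> b \<Longrightarrow> \<tau> x = x"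
    using neq by (auto simp: \<tau>_def inj_def)
  let ?F = "\<lambda>u. filter (\<lambda>c. c = b \<or> c = q) u"
  have "?F (map \<tau> (map fst w')) = ?F (map fst w')"
  proof (rule rewrite_arcs_two_homs_eq[OF rw, of "\<lambda>u. ?F (map \<tau> (map fst u))" "\<lambda>u. ?F (map fst u)"])
    fix u
    assume "set u \<subseteq> set w"
    then have "\<forall>x\<in>set u. \<tau> (fst x) = fst x"
      using fresh \<tau>(4) by force
    then show "?F (map \<tau> (map fst u)) = ?F (map fst u)"
      by (simp cong: map_cong)
  qed (use neq in \<open>auto simp: \<tau>_def arc_def\<close>)
  then have "alternating b q (map fst w') \<longleftrightarrow> alternating (\<tau> a) (\<tau> q) (map \<tau> (map fst w'))"
    by (simp add: alternating_def \<tau>)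
  also have "\<dots> \<longleftrightarrow> alternating a q (map fst w')"
    by (rule alternating_map) (rule inj_on_subset[OF \<tau>(1)], simp)
  finally have same: "alternating b q (map fst w') \<longleftrightarrow> alternating a q (map fst w')" .
  have "\<not> alternating a q (map fst w)" "\<not> alternating b q (map fst w)"
    using fresh by (auto intro!: alternating_not_mem)
  then show "intersection_index (PG w k) q = intersection_index (PG w' k) q"
    using neq same a b \<open>a \<noteq> b\<close>
    by (intro intersection_index_eqI[of "{a, b}"] rewrite_arcs_alternating_eq[OF rw]) (auto simp: arc_def)
qed (use a b in \<open>auto intro!: filter_arc_eq\<close>)

lemma R3_same_prechords:
  assumes a: "k a = Classical \<epsilon>\<^sub>a" and b: "k b = Classical \<epsilon>\<^sub>b" and c: "k c = Classical \<epsilon>\<^sub>c"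
    and rw: "rewrite_arcs
          {# (arc o\<^sub>T (a, Tail) (b, Tail), arc (- o\<^sub>T) (a, Tail) (b, Tail)),
             (arc o\<^sub>M (a, Head) (c, Tail), arc (- o\<^sub>M) (a, Head) (c, Tail)),
             (arc o\<^sub>B (b, Head) (c, Head), arc (- o\<^sub>B) (b, Head) (c, Head)) #} w w'"
  shows "same_prechords (PG w k) (PG w' k)"
proof (rule same_prechordsI[OF rw])
  fix q
  assume q: "k q = Precrossing"
  show "intersection_index (PG w k) q = intersection_index (PG w' k) q"
    using a b c q
    by (intro intersection_index_eqI[of "{}"] rewrite_arcs_alternating_eq[OF rw])
      (auto intro!: filter_arc_eq)
qed (use a b c in \<open>auto intro!: filter_arc_eq\<close>)

text \<open>
  The only chords that pass each other are \<open>x\<close> and \<open>p\<close>, and they do so on both arcs: whether they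
  cross is toggled twice. Each chord has two ends, so the four endpoints on the arcs are all that
  the projection to \<open>x\<close> and \<open>p\<close> sees.
\<close>

lemma PR2_same_prechords:
  assumes "pseudo_gauss (PG w k)"
    and x: "k x = Classical \<epsilon>" and p: "k p = Precrossing"
    and o: "o\<^sub>1 \<in> {1, - 1}" "o\<^sub>2 \<in> {1, - 1}"
    and rw: "rewrite_arcs
          {# (arc o\<^sub>1 (x, e) (p, f), arc (- o\<^sub>1) (x, opp e) (p, opp f)),
             (arc o\<^sub>2 (x, opp e) (p, opp f), arc (- o\<^sub>2) (x, e) (p, f)) #} w w'"
  shows "same_prechords (PG w k) (PG w' k)"
proof (rule same_prechordsI[OF rw])
  have "x \<noteq> p"
    using x p by auto
  obtain s t where "w = s @ arc o\<^sub>1 (x, e) (p, f) @ t"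
    by (rule rewrite_arcs_factor[OF rw, of "arc o\<^sub>1 (x, e) (p, f)"]) auto
  then have "{x, p} \<subseteq> arrows (PG w k)"
    by (simp add: arrows_def)
  then have len: "length (filter (\<lambda>c. c \<in> {x, p}) (map fst w)) = 4"
    using length_filter_chord_names[OF assms(1), of "{x, p}"] \<open>x \<noteq> p\<close> by simp
  have "rewrite_arcs {#(arc o\<^sub>1 x p, arc (- o\<^sub>1) x p), (arc o\<^sub>2 x p, arc (- o\<^sub>2) x p)#}
      (filter (\<lambda>c. c \<in> {x, p}) (map fst w)) (filter (\<lambda>c. c \<in> {x, p}) (map fst w'))"
    using rewrite_arcs_hom[OF rw, of "\<lambda>u. filter (\<lambda>c. c \<in> {x, p}) (map fst u)"]
    by (simp add: arc_def split: if_splits)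
  then obtain L where "mset L = {#(arc o\<^sub>1 x p, arc (- o\<^sub>1) x p), (arc o\<^sub>2 x p, arc (- o\<^sub>2) x p)#}"
    and L: "filter (\<lambda>c. c \<in> {x, p}) (map fst w) = concat (map fst L)"
      "filter (\<lambda>c. c \<in> {x, p}) (map fst w') = concat (map snd L)"
    by (rule rewrite_arcs_exact) (subst len, simp add: arc_def)
  \<comment> \<open>Both arcs are reversed, so an alternating word of \<open>x\<close> and \<open>p\<close> remains alternating.\<close>
  then have "alternating x p (concat (map fst L)) \<longleftrightarrow> alternating x p (concat (map snd L))"
    using o \<open>x \<noteq> p\<close> by (auto simp: mset_eq_two_iff alternating_def arc_def)
  then have xp: "alternating x p (map fst w) \<longleftrightarrow> alternating x p (map fst w')"
    unfolding L[symmetric] by (simp add: alternating_filter)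
  fix q
  assume q: "k q = Precrossing"
  show "intersection_index (PG w k) q = intersection_index (PG w' k) q"
  proof (rule intersection_index_eqI[of "{}"])
    fix a
    assume "is_Classical (k a)"
    then have "a \<noteq> q" "a \<noteq> p" "x \<noteq> q"
      using x p q by (metis arrow_kind.disc(1,2))+
    show "alternating a q (map fst w) \<longleftrightarrow> alternating a q (map fst w')"
    proof (cases "a = x \<and> q = p")
      case False
      then show ?thesis
        using \<open>a \<noteq> q\<close> \<open>a \<noteq> p\<close> \<open>x \<noteq> q\<close> by (intro rewrite_arcs_alternating_eq[OF rw]) (auto simp: arc_def)
    qed (use xp in simp)
  qed simp_all
qed (use x p in \<open>auto intro!: filter_arc_eq\<close>)

text \<open>
  The combinatorial core of PR3, as a finite check over the orders of the arcs and of the endpoints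
  on them. The chords \<open>a\<close> and \<open>p\<close> exchange endpoints on one arc only, which toggles their
  intersection; likewise \<open>b\<close> and \<open>p\<close>. If the three arcs follow each other cyclically in the
  order of the assumption, then \<open>a\<close> crosses \<open>p\<close> iff \<open>o\<^sub>X = - 1\<close>, and \<open>b\<close> crosses \<open>p\<close> iff \<open>o\<^sub>Y = 1\<close>; in the other
  cyclic order both conditions are reversed. In either case the two intersections agree iff
  \<open>o\<^sub>X \<noteq> o\<^sub>Y\<close>.
\<close>

lemma three_arcs_alternating:
  assumes "distinct [a, b, p]"
    and o: "o\<^sub>T \<in> {1, - 1}" "o\<^sub>X \<in> {1, - 1}" "o\<^sub>Y \<in> {1, - 1}"
    and L: "mset L = {#(arc o\<^sub>T a b, arc (- o\<^sub>T) a b), (arc o\<^sub>X a p, arc (- o\<^sub>X) a p),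
                       (arc o\<^sub>Y b p, arc (- o\<^sub>Y) b p)#}"
  shows "(alternating a p (concat (map snd L)) \<longleftrightarrow> \<not> alternating a p (concat (map fst L))) \<and>
    (alternating b p (concat (map snd L)) \<longleftrightarrow> \<not> alternating b p (concat (map fst L))) \<and>
    ((alternating a p (concat (map fst L)) \<longleftrightarrow> alternating b p (concat (map fst L)))
      \<longleftrightarrow> o\<^sub>X \<noteq> o\<^sub>Y)"
proof -
  have neq: "a \<noteq> b" "a \<noteq> p" "b \<noteq> p" "b \<noteq> a" "p \<noteq> a" "p \<noteq> b"
    using assms(1) by auto
  have signs: "o\<^sub>T = 1 \<or> o\<^sub>T = - 1" "o\<^sub>X = 1 \<or> o\<^sub>X = - 1" "o\<^sub>Y = 1 \<or> o\<^sub>Y = - 1"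
    using o by auto
  show ?thesis
    using mset_eq_three[OF L] unfolding insert_iff empty_iff
    by (elim disjE; insert signs; elim disjE; simp add: neq alternating_def arc_def)
qed

text \<open>
  Since \<open>\<eta> * o\<^sub>X * \<epsilon>\<^sub>a = \<eta> * o\<^sub>Y * \<epsilon>\<^sub>b\<close>, the signs \<open>\<epsilon>\<^sub>a\<close> and \<open>\<epsilon>\<^sub>b\<close> are equal iff \<open>o\<^sub>X = o\<^sub>Y\<close>, that is, iff exactly
  one of \<open>a\<close>, \<open>b\<close> crosses \<open>p\<close>. So with equal signs the move exchanges the roles of \<open>a\<close> and \<open>b\<close>, and
  with opposite signs it adds or removes two cancelling crossings.
\<close>

lemma PR3_same_prechords:
  assumes "pseudo_gauss (PG w k)"
    and p: "k p = Precrossing" and a: "k a = Classical \<epsilon>\<^sub>a" and b: "k b = Classical \<epsilon>\<^sub>b"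
    and \<eta>: "\<eta> \<in> {1, - 1}"
    and o: "o\<^sub>T \<in> {1, - 1}" "o\<^sub>X \<in> {1, - 1}" "o\<^sub>Y \<in> {1, - 1}"
    and compat: "\<eta> * o\<^sub>X * \<epsilon>\<^sub>a = \<eta> * o\<^sub>Y * \<epsilon>\<^sub>b"
    and rw: "rewrite_arcs
          {# (arc o\<^sub>T (a, t) (b, t), arc (- o\<^sub>T) (a, t) (b, t)),
             (arc o\<^sub>X (a, opp t) (p, Tail), arc (- o\<^sub>X) (a, opp t) (p, Tail)),
             (arc o\<^sub>Y (b, opp t) (p, Head), arc (- o\<^sub>Y) (b, opp t) (p, Head)) #} w w'"
  shows "same_prechords (PG w k) (PG w' k)"
proof (rule same_prechordsI[OF rw])
  obtain s\<^sub>T r\<^sub>T where w_T: "w = s\<^sub>T @ arc o\<^sub>T (a, t) (b, t) @ r\<^sub>T"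
    by (rule rewrite_arcs_factor[OF rw, of "arc o\<^sub>T (a, t) (b, t)"]) auto
  then have "{a, b} \<subseteq> arrows (PG w k)"
    by (simp add: arrows_def)
  moreover obtain s\<^sub>X r\<^sub>X where "w = s\<^sub>X @ arc o\<^sub>X (a, opp t) (p, Tail) @ r\<^sub>X"
    by (rule rewrite_arcs_factor[OF rw, of "arc o\<^sub>X (a, opp t) (p, Tail)"]) auto
  then have "p \<in> arrows (PG w k)"
    by (simp add: arrows_def)
  ultimately have in_w: "{a, b, p} \<subseteq> arrows (PG w k)"
    by simp
  have \<epsilon>: "\<epsilon>\<^sub>a \<in> {1, - 1}" "\<epsilon>\<^sub>b \<in> {1, - 1}"
    using assms(1) in_w a b by (auto simp: pseudo_gauss_def)
  have "a \<noteq> b"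
    using assms(1) w_T by (auto simp: pseudo_gauss_def arc_def split: if_splits)
  then have dist: "distinct [a, b, p]"
    using a b p by auto
  let ?S = "{a, b, p}"
  let ?h = "\<lambda>u. filter (\<lambda>c. c \<in> ?S) (map fst u)"
  have len: "length (?h w) = 6"
    using length_filter_chord_names[OF assms(1) _ in_w] dist by simp
  have "rewrite_arcs {#(arc o\<^sub>T a b, arc (- o\<^sub>T) a b), (arc o\<^sub>X a p, arc (- o\<^sub>X) a p),
      (arc o\<^sub>Y b p, arc (- o\<^sub>Y) b p)#} (?h w) (?h w')"
    using rewrite_arcs_hom[OF rw, of ?h] by (simp add: arc_def split: if_splits)
  then obtain L where L: "mset L = {#(arc o\<^sub>T a b, arc (- o\<^sub>T) a b), (arc o\<^sub>X a p, arc (- o\<^sub>X) a p),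
      (arc o\<^sub>Y b p, arc (- o\<^sub>Y) b p)#}"
    and hw: "?h w = concat (map fst L)" and hw': "?h w' = concat (map snd L)"
    by (rule rewrite_arcs_exact) (subst len, simp add: arc_def)
  have w: "alternating c p (map fst w) \<longleftrightarrow> alternating c p (concat (map fst L))" if "c \<in> ?S" for c
    using that unfolding hw[symmetric] by (simp add: alternating_filter)
  have w': "alternating c p (map fst w') \<longleftrightarrow> alternating c p (concat (map snd L))" if "c \<in> ?S" for c
    using that unfolding hw'[symmetric] by (simp add: alternating_filter)
  have flip: "alternating a p (map fst w') \<longleftrightarrow> \<not> alternating a p (map fst w)"
    "alternating b p (map fst w') \<longleftrightarrow> \<not> alternating b p (map fst w)"
    "(alternating a p (map fst w) \<longleftrightarrow> alternating b p (map fst w)) \<longleftrightarrow> o\<^sub>X \<noteq> o\<^sub>Y"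
    using three_arcs_alternating[OF dist o L] by (simp_all add: w w')
  have "o\<^sub>X \<noteq> o\<^sub>Y \<longleftrightarrow> \<epsilon>\<^sub>a \<noteq> \<epsilon>\<^sub>b"
    using compat o \<epsilon> \<eta> by auto
  then have sum_p: "\<epsilon>\<^sub>a * of_bool (alternating a p (map fst w)) + \<epsilon>\<^sub>b * of_bool (alternating b p (map fst w))
      = \<epsilon>\<^sub>a * of_bool (alternating a p (map fst w')) + \<epsilon>\<^sub>b * of_bool (alternating b p (map fst w'))"
    using flip \<epsilon> by auto
  fix q
  assume q: "k q = Precrossing"
  have other: "alternating c q (map fst w) \<longleftrightarrow> alternating c q (map fst w')"
    if "is_Classical (k c)" "c \<notin> {a, b} \<or> q \<noteq> p" for c
  proof (rule rewrite_arcs_alternating_eq[OF rw])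
    have "q \<noteq> a" "q \<noteq> b" "c \<noteq> p" 
      using that(1) q a b p by (metis arrow_kind.disc(1,2))+
    then show "\<forall>(x, y)\<in>#{#(arc o\<^sub>T (a, t) (b, t), arc (- o\<^sub>T) (a, t) (b, t)),
             (arc o\<^sub>X (a, opp t) (p, Tail), arc (- o\<^sub>X) (a, opp t) (p, Tail)),
             (arc o\<^sub>Y (b, opp t) (p, Head), arc (- o\<^sub>Y) (b, opp t) (p, Head)) #}.
        filter (\<lambda>d. d = c \<or> d = q) (map fst x) = filter (\<lambda>d. d = c \<or> d = q) (map fst y)"
      using that dist by (auto intro!: filter_arc_eq)
  qed
  show "intersection_index (PG w k) q = intersection_index (PG w' k) q"
  proof (rule intersection_index_eqI[of "{a, b}"])
    show "(\<Sum>c\<in>{a, b}. weight (k c) * of_bool (alternating c q (map fst w)))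
      = (\<Sum>c\<in>{a, b}. weight (k c) * of_bool (alternating c q (map fst w')))"
    proof (cases "q = p")
      case True
      then show ?thesis
        using sum_p a b \<open>a \<noteq> b\<close> by (simp del: sum_mult_of_bool_eq)
    next
      case False
      then show ?thesis
        using other a b by (intro sum.cong) auto
    qed
  qed (use other in auto)
qed (use a b p in \<open>auto intro!: filter_arc_eq\<close>)

text \<open>
  The new prechord is trivial, and deleting it first gives back the prechord word of the smaller
  diagram.
\<close>

lemma PR1_delete_trivial:
  assumes "pseudo_gauss (PG w k)" and "pseudo_gauss (PG w' k)"
    and p: "k p = Precrossing"
    and rw: "rewrite_arcs {#([], [(p, e), (p, e')])#} w w'"
  shows "zw_iso (delete_trivial (prechord_word (PG w k))) (delete_trivial (prechord_word (PG w' k)))"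
proof -
  obtain s t where w: "w = s @ t" and w': "w' = s @ [(p, e), (p, e')] @ t"
    using insert_one_arrow[OF rw] .
  let ?E = "prechord_word (PG w k)" and ?E' = "prechord_word (PG w' k)"
  let ?F = "filter (\<lambda>c. k c = Precrossing)"
  have fresh: "p \<notin> fst ` set w"
    by (rule inserted_arrows_fresh[OF assms(1,2) rw, of _ _ _ e]) auto
  have word: "zw_word ?E' = ?F (map fst s) @ [p, p] @ ?F (map fst t)"
    "zw_word ?E = ?F (map fst s) @ ?F (map fst t)"
    using p by (simp_all add: zw_word_prechord_PG w w')
  have "rotate (length (?F (map fst s))) (zw_word ?E') = p # p # ?F (map fst t) @ ?F (map fst s)"
    unfolding word by (subst rotate_append) simp
  then have "adjacent_ends ?E' p"
    unfolding adjacent_ends_def by blast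
  moreover have "intersection_index (PG w' k) p = 0"
  proof -
    have "weight (k a) * of_bool (intersect (PG w' k) a p) = 0" for a
    proof (cases "a = p")
      case False
      then have "\<not> alternating p a (map fst w')"
        using not_alternating_adjacent[of p a "map fst s" "map fst t"] by (simp add: w')
      then show ?thesis
        by (simp add: intersect_alternating alternating_commute)
    qed (use p in simp)
    then have "(\<Sum>a\<in>arrows (PG w' k). weight (k a) * of_bool (intersect (PG w' k) a p)) = 0"
      by (intro sum.neutral ballI)
    moreover have "finite (arrows (PG w' k))"
      by (simp add: arrows_def)
    ultimately show ?thesis
      using intersection_index_sum[of "arrows (PG w' k)" "PG w' k" p] by (simp only: pg_diagram.sel)
  qed
  ultimately have "trivial_chord ?E' p"
    by (simp add: trivial_chord_def word(1)) (simp add: prechord_word_def)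
  then have del: "delete_trivial (delete_chords {p} ?E') = delete_trivial ?E'"
    by (intro delete_trivial_delete_chords) simp
  have index: "intersection_index (PG w k) q = intersection_index (PG w' k) q"
    if "q \<in> fst ` set w" for q
  proof (rule intersection_index_eqI[of "{}"])
    fix a
    assume "is_Classical (k a)"
    moreover have "q \<noteq> p"
      using that fresh by auto
    ultimately show "alternating a q (map fst w) \<longleftrightarrow> alternating a q (map fst w')"
      using p by (intro rewrite_arcs_alternating_eq[OF rw]) auto
  qed simp_all
  have "zw_word (delete_chords {p} ?E') = zw_word ?E"
  proof -
    have "filter (\<lambda>c. c \<notin> {p}) (?F u) = ?F u" if "p \<notin> set u" for u
      using that by (intro filter_True) auto
    then show ?thesis
      using fresh by (simp add: delete_chords_def word) (simp add: w image_Un)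
  qed
  moreover have "zw_dec (delete_chords {p} ?E') = intersection_index (PG w' k)"
    by (simp add: delete_chords_def prechord_word_def)
  ultimately have "zw_iso ?E (delete_chords {p} ?E')"
    unfolding zw_iso_def
    by (intro exI[of _ id] exI[of _ 0]) (auto simp: prechord_word_def index)
  from zw_iso_delete_trivial[OF this] show ?thesis
    by (simp only: del)
qed

lemma zw_iso_prechord_word:
  assumes "pg_iso D D'"
  shows "zw_iso (prechord_word D) (prechord_word D')"
proof -
  obtain f n where f: "inj_on f (arrows D)"
    and w: "pg_word D' = rotate n (map (\<lambda>(c, e). (f c, e)) (pg_word D))"
    and k: "\<forall>c\<in>arrows D. pg_kind D' (f c) = pg_kind D c"
    using assms unfolding pg_iso_def by blast
  have names: "chord_names D' = rotate n (map f (chord_names D))"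
    by (simp add: w rotate_map[symmetric] comp_def case_prod_beta)
  have set_names: "set (chord_names D) = arrows D"
    by (simp add: arrows_def)
  have arr: "arrows D' = f ` arrows D"
    by (metis set_names names set_rotate set_map arrows_def list.set_map)
  have fin: "finite (arrows D)"
    by (simp add: arrows_def)
  have int: "intersect D' (f a) (f c) \<longleftrightarrow> intersect D a c" if "a \<in> arrows D" "c \<in> arrows D" for a c
    unfolding intersect_alternating names alternating_rotate
    by (rule alternating_map) (use f that set_names in \<open>simp add: insert_absorb\<close>)
  have index: "intersection_index D' (f c) = intersection_index D c" if "c \<in> arrows D" for c
  proof -
    have "intersection_index D' (f c)
        = (\<Sum>a\<in>f ` arrows D. weight (pg_kind D' a) * of_bool (intersect D' a (f c)))"
      using fin arr by (intro intersection_index_sum) auto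
    also have "\<dots> = (\<Sum>a\<in>arrows D. weight (pg_kind D a) * of_bool (intersect D a c))"
      using that k int by (subst sum.reindex[OF f]) (auto intro: sum.cong)
    also have "\<dots> = intersection_index D c"
      using fin by (intro intersection_index_sum[symmetric]) auto
    finally show ?thesis .
  qed
  obtain m where "zw_word (prechord_word D')
      = rotate m (filter (\<lambda>c. pg_kind D' c = Precrossing) (map f (chord_names D)))"
    by (rule filter_rotate[of "\<lambda>c. pg_kind D' c = Precrossing" n "map f (chord_names D)"])
      (simp add: prechord_word_def names)
  also have "filter (\<lambda>c. pg_kind D' c = Precrossing) (map f (chord_names D))
      = map f (zw_word (prechord_word D))"
  proof -
    have "filter (\<lambda>c. pg_kind D' (f c) = Precrossing) (chord_names D) = zw_word (prechord_word D)"
      using k unfolding prechord_word_def zchord_word.sel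
      by (intro filter_cong) (simp_all only: set_names)
    then show ?thesis
      by (simp only: filter_map comp_def)
  qed
  finally show ?thesis
    unfolding zw_iso_def using f index set_names
    by (intro exI[of _ f] exI[of _ m])
      (auto simp: prechord_word_def intro: inj_on_subset)
qed

lemma pg_move_zw_iso:
  assumes "pg_move D D'" and D: "pseudo_gauss D" "pseudo_gauss D'"
  shows "zw_iso (delete_trivial (prechord_word D)) (delete_trivial (prechord_word D'))"
proof -
  have *: ?thesis if "same_prechords D D'"
    using that by (intro zw_iso_delete_trivial same_prechords_zw_iso)
  from assms(1) show ?thesis
  proof cases
    case R1
    show ?thesis
      by (rule *) (use R1 D R1_same_prechords in metis)
  next
    case R2
    show ?thesis
      by (rule *) (use R2 D R2_same_prechords in metis)
  next
    case R3
    show ?thesis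
      by (rule *, unfold R3(1,2)) (rule R3_same_prechords[OF R3(3,4,5,11)])
  next
    case PR1
    then show ?thesis
      using D PR1_delete_trivial by metis
  next
    case PR2
    show ?thesis
      by (rule *, unfold PR2(1,2)) (rule PR2_same_prechords[OF D(1)[unfolded PR2(1)] PR2(3,4,6,7,8)])
  next
    case (PR3 k p a \<epsilon>\<^sub>a b \<epsilon>\<^sub>b t \<eta> o\<^sub>T o\<^sub>X o\<^sub>Y w w')
    have "\<eta> \<in> {1, - 1}"
      using PR3(6) by auto
    show ?thesis
      by (rule *, unfold PR3(1,2))
        (rule PR3_same_prechords[OF D(1)[unfolded PR3(1)] PR3(3,4,5) \<open>\<eta> \<in> {1, - 1}\<close> PR3(7,8,9,10,12)])
  qed
qed

lemma pseudoknot_step_I_map: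
  assumes "pseudoknot_step D D'"
  shows "I_map D = I_map D'"
proof -
  have D: "pseudo_gauss D" "pseudo_gauss D'"
    using assms by (auto simp: pseudoknot_step_def)
  have "zw_iso (delete_trivial (prechord_word D)) (delete_trivial (prechord_word D'))"
    using assms unfolding pseudoknot_step_def
    by (auto intro: pg_move_zw_iso zw_iso_prechord_word zw_iso_delete_trivial)
  then have "same_zchord (delete_trivial (prechord_word D)) (delete_trivial (prechord_word D'))"
    using same_zchord_I_map[OF D(1)] same_zchord_I_map[OF D(2)] by (simp add: same_zchord_def)
  then show ?thesis
    unfolding I_map_def by (rule Quotient_rel_abs[OF Quotient_ZC])
qed

theorem theorem1:
  fixes P P' :: pg_diagram
  assumes "pseudo_gauss P" and "pseudo_gauss P'"
    and "same_virtual_pseudoknot P P'"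
  shows "I_map P = I_map P'"
  using assms(3) unfolding same_virtual_pseudoknot_def
proof (induction rule: equivclp_induct)
  case base
  show ?case
    by simp
next
  case (step Q R)
  then show ?case
    using pseudoknot_step_I_map by metis
qed

end
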